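(* Let $\vec X=(X_1,\dots,X_n)$ be independent random variables uniformly distributed on $[0,1]$, let $\vec X_\downarrow=(X_{(1)},\dots,X_{(n)})$, $X_{(1)}\ge\dots\ge X_{(n)}$, be its descending arrangement, let $\mu$ be a random permutation of $\{1,\dots,n\}$ defined on the same probability space, and let $\vec Y=\vec X_\downarrow^{\mu}=(X_{(\mu_1)},\dots,X_{(\mu_n)})$. If $\vec Y$ satisfies the strong rank independence condition and $\vec X_\downarrow$ and $\mu$ are independent, then $\vec Y$ is a constant rearrangement, i.e. there is a fixed permutation $\mathfrak s$ of $\{1,\dots,n\}$ such that $\mu=\mathfrak s$ almost surely.
   Context: For a random sequence $\vec Y=(Y_1,\dots,Y_n)$ (almost surely without ties) the initial ranks are $\mathfrak R_k=1+\#\{i<k: Y_i>Y_k\}$, $k=1,\dots,n$. The strong rank independence condition for $\vec Y$: for each $k=1,\dots,n-1$, the random vector $(\mathfrak R_{k+1},\dots,\mathfrak R_n)$ is independent of the random vector $(Y_1,\dots,Y_k)$. Every rearrangement of $\vec X$ (a sequence equal in distribution to $(X_{\sigma_1},\dots,X_{\sigma_n})$ for some random permutation $\sigma$ on the probability space of $\vec X$) is, up to equality in distribution, of the form $\vec X_\downarrow^{\mu}$ for a random permutation $\mu$; this is the $\mu$ referred to in the statement. *)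

theory Defs
  imports "HOL-Probability.Probability"
begin

text \<open>
  Random sequences \<open>Y\<^sub>1, \<dots>, Y\<^sub>n\<close> are families \<open>Y :: nat \<Rightarrow> 'a \<Rightarrow> real\<close> of which
  only the indices in \<open>{1..n}\<close> are relevant.
\<close>

text \<open>\<open>desc_stat n X k\<close> is the \<open>k\<close>-th largest of \<open>X 1, \<dots>, X n\<close>, for \<open>k \<in> {1..n}\<close>.\<close>

definition desc_stat :: "nat \<Rightarrow> (nat \<Rightarrow> 'a \<Rightarrow> real) \<Rightarrow> nat \<Rightarrow> 'a \<Rightarrow> real" where
  "desc_stat n X k \<omega> = rev (sort (map (\<lambda>i. X i \<omega>) [1..<Suc n])) ! (k - 1)"

definition rearrangement ::
    "nat \<Rightarrow> (nat \<Rightarrow> 'a \<Rightarrow> real) \<Rightarrow> ('a \<Rightarrow> nat \<Rightarrow> nat) \<Rightarrow> nat \<Rightarrow> 'a \<Rightarrow> real" where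
  "rearrangement n X \<mu> k \<omega> = desc_stat n X (\<mu> \<omega> k) \<omega>"

definition initial_rank :: "(nat \<Rightarrow> 'a \<Rightarrow> real) \<Rightarrow> nat \<Rightarrow> 'a \<Rightarrow> nat" where
  "initial_rank Y k \<omega> = 1 + card {i \<in> {1..<k}. Y i \<omega> > Y k \<omega>}"

definition permutation_space :: "nat \<Rightarrow> (nat \<Rightarrow> nat) measure" where
  "permutation_space n = count_space {p. p permutes {1..n}}"

context prob_space
begin

text \<open>
  The library predicate \<open>indep_var\<close> forces both random variables to have values in the
  same type. The following is its unfolding with that restriction removed.
\<close>

definition indep_rv ::
    "'b measure \<Rightarrow> ('a \<Rightarrow> 'b) \<Rightarrow> 'c measure \<Rightarrow> ('a \<Rightarrow> 'c) \<Rightarrow> bool" where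
  "indep_rv S A T B \<longleftrightarrow>
     random_variable S A \<and> random_variable T B \<and>
     indep_set {A -` U \<inter> space M | U. U \<in> sets S} {B -` V \<inter> space M | V. V \<in> sets T}"

lemma indep_rv_iff_indep_var: "indep_rv S A T B \<longleftrightarrow> indep_var S A T B"
proof -
  have "case_bool {A -` U \<inter> space M | U. U \<in> sets S} {B -` V \<inter> space M | V. V \<in> sets T} =
      (\<lambda>i. {case_bool A B i -` U \<inter> space M | U. U \<in> sets (case_bool S T i)})"
    by (rule ext) (simp split: bool.split)
  then show ?thesis
    unfolding indep_rv_def indep_var_def indep_vars_def2 indep_set_def
    by (auto simp: UNIV_bool)
qed

text \<open>
  The condition is meant for sequences without ties almost surely; this is not part of the
  predicate.
\<close>

definition strong_rank_independence :: "nat \<Rightarrow> (nat \<Rightarrow> 'a \<Rightarrow> real) \<Rightarrow> bool" where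
  "strong_rank_independence n Y \<longleftrightarrow>
     (\<forall>k\<in>{1..<n}.
        indep_rv
          (\<Pi>\<^sub>M j\<in>{k+1..n}. count_space UNIV) (\<lambda>\<omega>. \<lambda>j\<in>{k+1..n}. initial_rank Y j \<omega>)
          (\<Pi>\<^sub>M i\<in>{1..k}. borel) (\<lambda>\<omega>. \<lambda>i\<in>{1..k}. Y i \<omega>))"

end

end

theory Submission
  imports Defs
begin

text \<open>
  Where there are no ties, the ranks of \<open>Y\<close> are those of the permutation \<open>\<mu>\<close>, and the ranks with
  indices above \<open>k\<close> determine \<open>\<mu>\<close> on \<open>{k+1..n}\<close>. Arguing by induction on \<open>k\<close>, suppose that
  \<open>\<mu>\<close> is almost surely constant on \<open>{1..<k}\<close>. Then those ranks determine \<open>\<mu> k\<close> too, so the event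
  \<open>\<mu> k = j\<close> is independent of \<open>Y k\<close>. Since \<open>Y k\<close> is the \<open>j\<close>-th order statistic on that event,
  and \<open>\<mu>\<close> is independent of the order statistics, the expectation of the \<open>j\<close>-th order statistic
  equals that of \<open>Y k\<close> for every \<open>j\<close> with \<open>P(\<mu> k = j) > 0\<close>. These expectations are strictly
  decreasing in \<open>j\<close>, so there is only one such \<open>j\<close>.
\<close>

section \<open>Ranks of permutations and how they determine values\<close>

text \<open>Smaller values count as preceding, opposite to \<open>initial_rank\<close>: the values
  of \<open>p\<close> serve as positions in the descending order, where a smaller position carries a
  larger number.\<close>

definition perm_rank :: "(nat \<Rightarrow> nat) \<Rightarrow> nat \<Rightarrow> nat" where
  "perm_rank p k = 1 + card {i \<in> {1..<k}. p i < p k}"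

text \<open>For a bijection, the image of an initial segment is the complement of the image of the
  tail.\<close>

lemma permutes_image_initial_eq:
  fixes p q :: "nat \<Rightarrow> nat"
  assumes p: "p permutes {1..n}" and q: "q permutes {1..n}" and "k \<le> n"
    and eq: "\<And>i. i \<in> {k+1..n} \<Longrightarrow> p i = q i"
  shows "p ` {1..k} = q ` {1..k}"
proof -
  have *: "r ` {1..k} = {1..n} - r ` {k+1..n}" if "r permutes {1..n}" for r :: "nat \<Rightarrow> nat"
  proof -
    have "{1..k} = {1..n} - {k+1..n}"
      using \<open>k \<le> n\<close> by auto
    then have "r ` {1..k} = r ` {1..n} - r ` {k+1..n}"
      by (simp add: image_set_diff permutes_inj[OF that])
    then show ?thesis
      by (simp only: permutes_image[OF that])
  qed
  have "p ` {k+1..n} = q ` {k+1..n}"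
    using eq by (rule image_cong[OF refl])
  then show ?thesis
    by (simp only: *[OF p] *[OF q])
qed

lemma card_less_inj:
  fixes x y :: "'a :: linorder"
  assumes "finite S" "x \<in> S" "y \<in> S" "card {z \<in> S. z < x} = card {z \<in> S. z < y}"
  shows "x = y"
proof (rule ccontr)
  have *: "card {z \<in> S. z < a} < card {z \<in> S. z < b}" if "a < b" "a \<in> S" for a b
    using that \<open>finite S\<close> by (intro psubset_card_mono) auto
  assume "x \<noteq> y"
  then consider "x < y" | "y < x"
    by (rule neqE)
  then show False
    using *[of x y] *[of y x] assms(2-4) by cases auto
qed

lemma perm_rank_eq_card_image:
  assumes "p permutes {1..n}" "1 \<le> k"
  shows "perm_rank p k = 1 + card {z \<in> p ` {1..k}. z < p k}"
proof -
  have "{z \<in> p ` {1..k}. z < p k} = p ` {i \<in> {1..<k}. p i < p k}"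
  proof (safe)
    fix i assume "i \<in> {1..k}" "p i < p k"
    then show "p i \<in> p ` {i \<in> {1..<k}. p i < p k}"
      by (cases "i = k") auto
  qed auto
  then show ?thesis
    by (simp add: perm_rank_def card_image permutes_inj_on[OF assms(1)])
qed

text \<open>Downward induction from \<open>n\<close>: once \<open>p\<close> and \<open>q\<close>
  agree above \<open>i\<close>, they take the same set of values on \<open>{1..i}\<close>, and the
  rank at \<open>i\<close> singles out one element of that set.\<close>

lemma perm_rank_tail_determines:
  assumes p: "p permutes {1..n}" and q: "q permutes {1..n}"
    and eq: "\<And>i. i \<in> {k+1..n} \<Longrightarrow> perm_rank p i = perm_rank q i"
    and "i \<in> {k+1..n}"
  shows "p i = q i"
  using \<open>i \<in> {k+1..n}\<close>
proof (induction "n - i" arbitrary: i rule: less_induct)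
  case less
  have "p ` {1..i} = q ` {1..i}"
    using less by (intro permutes_image_initial_eq[OF p q]) auto
  moreover have "perm_rank p i = perm_rank q i"
    using eq less.prems by blast
  moreover have "1 \<le> i"
    using less.prems by auto
  ultimately have "card {z \<in> p ` {1..i}. z < p i} = card {z \<in> p ` {1..i}. z < q i}"
    by (simp add: perm_rank_eq_card_image[OF p] perm_rank_eq_card_image[OF q])
  moreover have "p i \<in> p ` {1..i}"
    using \<open>1 \<le> i\<close> by simp
  moreover have "q i \<in> p ` {1..i}"
    unfolding \<open>p ` {1..i} = q ` {1..i}\<close> using \<open>1 \<le> i\<close> by simp
  ultimately show ?case
    by (rule card_less_inj[OF finite_imageI[OF finite_atLeastAtMost], rotated 2])
qed

text \<open>\<open>p k\<close> is also \<open>q i\<close> for some \<open>i \<le> k\<close>; if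
  \<open>i\<close> differed from \<open>k\<close>, it would be \<open>p i\<close> as well, against
  injectivity.\<close>

lemma permutes_eq_at_remaining:
  fixes p q :: "nat \<Rightarrow> nat"
  assumes p: "p permutes {1..n}" and q: "q permutes {1..n}" and "k \<in> {1..n}"
    and eq: "\<And>i. i \<in> {1..n} \<Longrightarrow> i \<noteq> k \<Longrightarrow> p i = q i"
  shows "p k = q k"
proof -
  have "p ` {1..k} = q ` {1..k}"
    using assms by (intro permutes_image_initial_eq[OF p q]) auto
  then have "p k \<in> q ` {1..k}"
    using \<open>k \<in> {1..n}\<close> by fastforce
  then obtain i where i: "i \<in> {1..k}" "p k = q i"
    by auto
  have "i = k"
  proof (rule ccontr)
    assume "i \<noteq> k"
    then have "p i = p k"
      using i eq[of i] \<open>k \<in> {1..n}\<close> by auto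
    then show False
      using permutes_inj[OF p] \<open>i \<noteq> k\<close> by (auto dest: injD)
  qed
  then show ?thesis
    using i by simp
qed

section \<open>Order statistics and ranks of a rearrangement at a fixed sample point\<close>

lemma desc_stat_mem:
  assumes "k \<in> {1..n}"
  shows "\<exists>i\<in>{1..n}. desc_stat n X k \<omega> = X i \<omega>"
proof -
  let ?xs = "rev (sort (map (\<lambda>i. X i \<omega>) [1..<Suc n]))"
  have "?xs ! (k - 1) \<in> set ?xs"
    using assms by (intro nth_mem) auto
  then show ?thesis
    by (auto simp: desc_stat_def)
qed

lemma desc_stat_strict_decreasing:
  assumes inj: "inj_on (\<lambda>i. X i \<omega>) {1..n}" and "j \<in> {1..n}" "k \<in> {1..n}" "j < k"
  shows "desc_stat n X k \<omega> < desc_stat n X j \<omega>"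
proof -
  let ?ys = "sort (map (\<lambda>i. X i \<omega>) [1..<Suc n])"
  have "set [1..<Suc n] = {1..n}"
    by auto
  then have "distinct (map (\<lambda>i. X i \<omega>) [1..<Suc n])"
    using inj by (simp add: distinct_map del: upt_Suc)
  then have "sorted_wrt (<) ?ys"
    by (simp add: strict_sorted_iff del: upt_Suc)
  moreover have "length ?ys = n"
    by simp
  \<comment> \<open>Reversal moves the entry at position \<open>k - 1\<close> to position
    \<open>n - k\<close> of the ascending list.\<close>
  ultimately have "?ys ! (n - k) < ?ys ! (n - j)"
    using assms by (intro sorted_wrt_nth_less[of "(<)"]) auto
  then show ?thesis
    using assms by (simp add: desc_stat_def rev_nth del: upt_Suc)
qed

lemma initial_rank_rearrangement:
  assumes inj: "inj_on (\<lambda>i. X i \<omega>) {1..n}" and \<mu>: "\<mu> \<omega> permutes {1..n}" and k: "k \<in> {1..n}"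
  shows "initial_rank (rearrangement n X \<mu>) k \<omega> = perm_rank (\<mu> \<omega>) k"
proof -
  have "desc_stat n X (\<mu> \<omega> i) \<omega> > desc_stat n X (\<mu> \<omega> k) \<omega> \<longleftrightarrow> \<mu> \<omega> i < \<mu> \<omega> k"
    if "i \<in> {1..<k}" for i
  proof -
    have "\<mu> \<omega> i \<in> {1..n}" "\<mu> \<omega> k \<in> {1..n}"
      using that k permutes_in_image[OF \<mu>] by auto
    then show ?thesis
      using desc_stat_strict_decreasing[of X, OF inj, of "\<mu> \<omega> i" "\<mu> \<omega> k"]
        desc_stat_strict_decreasing[of X, OF inj, of "\<mu> \<omega> k" "\<mu> \<omega> i"]
      by (cases "\<mu> \<omega> i" "\<mu> \<omega> k" rule: linorder_cases) auto
  qed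
  then have "{i \<in> {1..<k}. desc_stat n X (\<mu> \<omega> i) \<omega> > desc_stat n X (\<mu> \<omega> k) \<omega>} =
      {i \<in> {1..<k}. \<mu> \<omega> i < \<mu> \<omega> k}"
    by blast
  then show ?thesis
    by (simp add: initial_rank_def perm_rank_def rearrangement_def)
qed

section \<open>Independence, atoms and expectations in a general probability space\<close>

context prob_space
begin

text \<open>The joint law is a product measure, and every slice of the diagonal is null because
  \<open>Y\<close> has no atoms.\<close>

lemma indep_var_AE_neq:
  fixes X Y :: "'a \<Rightarrow> real"
  assumes indep: "indep_var borel X borel Y" and atomless: "\<And>c. AE \<omega> in M. Y \<omega> \<noteq> c"
  shows "AE \<omega> in M. X \<omega> \<noteq> Y \<omega>"
proof -
  have rv[measurable]: "X \<in> borel_measurable M" "Y \<in> borel_measurable M"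
    using indep by (auto simp: indep_var_distribution_eq)
  interpret X: prob_space "distr M borel X" by (rule prob_space_distr) simp
  interpret Y: prob_space "distr M borel Y" by (rule prob_space_distr) simp
  interpret pair_sigma_finite "distr M borel X" "distr M borel Y" ..
  have "AE y in distr M borel Y. x \<noteq> y" for x
    using atomless[of x] by (subst AE_distr_iff) (auto simp: eq_commute)
  moreover have "{z \<in> space (borel \<Otimes>\<^sub>M borel). fst z \<noteq> (snd z :: real)} \<in> sets (borel \<Otimes>\<^sub>M borel)"
    by measurable
  ultimately have "AE z in distr M borel X \<Otimes>\<^sub>M distr M borel Y. fst z \<noteq> snd z"
    by (intro AE_pair_measure) (auto simp: space_pair_measure)
  also have "distr M borel X \<Otimes>\<^sub>M distr M borel Y = distr M (borel \<Otimes>\<^sub>M borel) (\<lambda>\<omega>. (X \<omega>, Y \<omega>))"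
    using indep by (simp add: indep_var_distribution_eq)
  finally show ?thesis
    by (subst (asm) AE_distr_iff) auto
qed

text \<open>Finitely many null values can be discarded together, so some value in \<open>A\<close>
  has positive probability, and by uniqueness all others are null.\<close>

lemma AE_const_if_unique_atom:
  fixes f :: "'a \<Rightarrow> 'b"
  assumes "finite A" and f: "f \<in> measurable M (count_space UNIV)"
    and range: "AE \<omega> in M. f \<omega> \<in> A"
    and unique: "\<And>a b. a \<in> A \<Longrightarrow> b \<in> A \<Longrightarrow> prob {\<omega> \<in> space M. f \<omega> = a} \<noteq> 0 \<Longrightarrow>
      prob {\<omega> \<in> space M. f \<omega> = b} \<noteq> 0 \<Longrightarrow> a = b"
  shows "\<exists>a. AE \<omega> in M. f \<omega> = a"
proof -
  have [measurable]: "{\<omega> \<in> space M. f \<omega> = a} \<in> sets M" for a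
    using measurable_sets[OF f, of "{a}"] by (simp add: vimage_def Int_def conj_commute)
  have null: "AE \<omega> in M. f \<omega> \<noteq> a" if "prob {\<omega> \<in> space M. f \<omega> = a} = 0" for a
    using that by (intro AE_I[of _ _ "{\<omega> \<in> space M. f \<omega> = a}"]) (auto simp: emeasure_eq_measure)
  have "\<exists>a\<in>A. prob {\<omega> \<in> space M. f \<omega> = a} \<noteq> 0"
  proof (rule ccontr)
    assume "\<not> ?thesis"
    then have "AE \<omega> in M. \<forall>a\<in>A. f \<omega> \<noteq> a"
      using \<open>finite A\<close> null by (intro AE_finite_allI) auto
    with range have "AE \<omega> in M. False"
      by eventually_elim auto
    then show False
      by simp
  qed
  then obtain a where a: "a \<in> A" "prob {\<omega> \<in> space M. f \<omega> = a} \<noteq> 0"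
    by blast
  then have "AE \<omega> in M. \<forall>b\<in>A - {a}. f \<omega> \<noteq> b"
    using \<open>finite A\<close> null unique by (intro AE_finite_allI) auto
  with range have "AE \<omega> in M. f \<omega> = a"
    by eventually_elim auto
  then show ?thesis ..
qed

text \<open>Composition only shrinks the two families of preimages, and independence passes to
  subfamilies.\<close>

lemma indep_rv_compose:
  assumes indep: "indep_rv S A T B" and f: "f \<in> measurable S S'" and g: "g \<in> measurable T T'"
  shows "indep_rv S' (\<lambda>\<omega>. f (A \<omega>)) T' (\<lambda>\<omega>. g (B \<omega>))"
proof -
  have A: "A \<in> measurable M S" and B: "B \<in> measurable M T"
    using indep by (auto simp: indep_rv_def)
  have vimage: "{(\<lambda>\<omega>. h (C \<omega>)) -` U \<inter> space M | U. U \<in> sets K'} \<subseteq> {C -` U \<inter> space M | U. U \<in> sets K}"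
    if C: "C \<in> measurable M K" and h: "h \<in> measurable K K'" for h C K K'
  proof safe
    fix U assume "U \<in> sets K'"
    then have "h -` U \<inter> space K \<in> sets K"
      using h by (rule measurable_sets[rotated])
    moreover have "(\<lambda>\<omega>. h (C \<omega>)) -` U \<inter> space M = C -` (h -` U \<inter> space K) \<inter> space M"
      using measurable_space[OF C] by auto
    ultimately show "\<exists>V. (\<lambda>\<omega>. h (C \<omega>)) -` U \<inter> space M = C -` V \<inter> space M \<and> V \<in> sets K"
      by blast
  qed
  have "indep_set {A -` U \<inter> space M | U. U \<in> sets S} {B -` V \<inter> space M | V. V \<in> sets T}"
    using indep by (simp add: indep_rv_def)
  then have "indep_set {(\<lambda>\<omega>. f (A \<omega>)) -` U \<inter> space M | U. U \<in> sets S'}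
      {(\<lambda>\<omega>. g (B \<omega>)) -` V \<inter> space M | V. V \<in> sets T'}"
    unfolding indep_set_def
    by (rule indep_sets_mono_sets) (use vimage[OF A f] vimage[OF B g] in \<open>auto split: bool.split\<close>)
  then show ?thesis
    using measurable_compose[OF A f] measurable_compose[OF B g] by (simp add: indep_rv_def)
qed

text \<open>One event has two descriptions: through \<open>f\<close> it is independent of
  \<open>Y\<close>, through \<open>g\<close> of \<open>Z\<close>. Since \<open>Y\<close> and
  \<open>Z\<close> agree on it, integrating over it gives
  \<open>p * expectation Y = p * expectation Z\<close>, where \<open>p\<close> is its nonzero
  probability.\<close>

lemma expectation_eq_of_indep_event:
  fixes Y Z :: "'a \<Rightarrow> real"
  assumes Y: "indep_rv N f borel Y" "integrable M Y" and S: "S \<in> sets N"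
    and Z: "indep_rv borel Z N' g" "integrable M Z" and T: "T \<in> sets N'"
    and nonnull: "prob {\<omega> \<in> space M. g \<omega> \<in> T} \<noteq> 0"
    and same_event: "AE \<omega> in M. f \<omega> \<in> S \<longleftrightarrow> g \<omega> \<in> T"
    and eq: "AE \<omega> in M. g \<omega> \<in> T \<longrightarrow> Y \<omega> = Z \<omega>"
  shows "expectation Y = expectation Z"
proof -
  have f[measurable]: "f \<in> measurable M N" and g[measurable]: "g \<in> measurable M N'"
    using Y(1) Z(1) by (auto simp: indep_rv_def)
  note S[measurable] T[measurable]
  have [measurable]: "Y \<in> borel_measurable M" "Z \<in> borel_measurable M"
    using Y(2) Z(2) by auto
  define p where "p = expectation (\<lambda>\<omega>. indicator T (g \<omega>) :: real)"
  have "p = expectation (indicator {\<omega> \<in> space M. g \<omega> \<in> T})"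
    unfolding p_def by (intro Bochner_Integration.integral_cong) (auto split: split_indicator)
  then have "p \<noteq> 0"
    using nonnull by simp
  have ind: "integrable M (\<lambda>\<omega>. indicator S (f \<omega>) :: real)"
      "integrable M (\<lambda>\<omega>. indicator T (g \<omega>) :: real)"
    by (auto intro!: integrable_const_bound[where B = 1] split: split_indicator)
  \<comment> \<open>Indicators turn the events into real variables, so that \<open>indep_var\<close>
    and its product formula for expectations apply.\<close>
  have indep: "indep_var borel (\<lambda>\<omega>. indicator S (f \<omega>) :: real) borel Y"
      "indep_var borel Z borel (\<lambda>\<omega>. indicator T (g \<omega>) :: real)"
    unfolding indep_rv_iff_indep_var[symmetric]
    using indep_rv_compose[OF Y(1), of "indicator S" borel id borel]
      indep_rv_compose[OF Z(1), of id borel "indicator T" borel]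
    by simp_all
  have "p = expectation (\<lambda>\<omega>. indicator S (f \<omega>))"
    unfolding p_def using same_event by (intro integral_cong_AE) (auto split: split_indicator)
  then have "p * expectation Y = expectation (\<lambda>\<omega>. indicator S (f \<omega>) * Y \<omega>)"
    using indep_var_lebesgue_integral[OF indep(1) ind(1) Y(2)] by simp
  also have "\<dots> = expectation (\<lambda>\<omega>. Z \<omega> * indicator T (g \<omega>))"
  proof (rule integral_cong_AE)
    show "AE \<omega> in M. indicator S (f \<omega>) * Y \<omega> = Z \<omega> * indicator T (g \<omega>)"
      using same_event eq by eventually_elim (auto split: split_indicator)
  qed auto
  also have "\<dots> = p * expectation Z"
    using indep_var_lebesgue_integral[OF indep(2) Z(2) ind(2)] by (simp add: p_def)
  finally show ?thesis
    using \<open>p \<noteq> 0\<close> by simp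
qed

end

section \<open>Absence of ties and expectations of the order statistics\<close>

locale independent_rearrangement = prob_space M
  for M :: "'a measure" +
  fixes n :: nat and X :: "nat \<Rightarrow> 'a \<Rightarrow> real" and \<mu> :: "'a \<Rightarrow> nat \<Rightarrow> nat"
  assumes indep_X: "indep_vars (\<lambda>_. borel) X {1..n}"
    and uniform_X: "\<And>i. i \<in> {1..n} \<Longrightarrow> distr M lborel (X i) = uniform_measure lborel {0..1}"
    and measurable_\<mu>[measurable]: "\<mu> \<in> measurable M (permutation_space n)"
    and rank_indep: "strong_rank_independence n (rearrangement n X \<mu>)"
    and indep_\<mu>: "indep_rv
           (\<Pi>\<^sub>M k\<in>{1..n}. borel) (\<lambda>\<omega>. \<lambda>k\<in>{1..n}. desc_stat n X k \<omega>)
           (permutation_space n) \<mu>"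
begin

abbreviation "Y \<equiv> rearrangement n X \<mu>"

lemma permutes_\<mu>: "\<omega> \<in> space M \<Longrightarrow> \<mu> \<omega> permutes {1..n}"
  using measurable_space[OF measurable_\<mu>] by (simp add: permutation_space_def)

lemma measurable_X: "i \<in> {1..n} \<Longrightarrow> X i \<in> borel_measurable M"
  using indep_X by (auto simp: indep_vars_def)

lemma AE_X_iff:
  assumes "i \<in> {1..n}" "Measurable.pred borel P"
  shows "(AE \<omega> in M. P (X i \<omega>)) \<longleftrightarrow> (AE x in uniform_measure lborel {0..1}. P x)"
proof -
  have "X i \<in> measurable M lborel" "{x \<in> space lborel. P x} \<in> sets lborel"
    using measurable_X[OF assms(1)] assms(2) by (auto simp: pred_def)
  from AE_distr_iff[OF this] show ?thesis
    unfolding uniform_X[OF assms(1)] by (rule sym)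
qed

lemma AE_X_neq: "i \<in> {1..n} \<Longrightarrow> AE \<omega> in M. X i \<omega> \<noteq> c"
  by (subst AE_X_iff[of i "\<lambda>x. x \<noteq> c"])
    (auto intro!: AE_uniform_measureI eventually_mono[OF AE_lborel_singleton])

lemma AE_X_bounds: "i \<in> {1..n} \<Longrightarrow> AE \<omega> in M. X i \<omega> \<in> {0..1}"
  by (subst AE_X_iff[of i "\<lambda>x. x \<in> {0..1}"]) (auto intro!: AE_uniform_measureI)

lemma AE_inj_on_X: "AE \<omega> in M. inj_on (\<lambda>i. X i \<omega>) {1..n}"
proof -
  have "AE \<omega> in M. X i \<omega> \<noteq> X j \<omega>" if "i \<in> {1..n}" "j \<in> {1..n} - {i}" for i j
  proof (rule indep_var_AE_neq)
    \<comment> \<open>Independence of subfamilies over disjoint index sets is applied to two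
      singletons; evaluation at the only index then gives the variables themselves.\<close>
    have "indep_var (PiM {i} (\<lambda>_. borel)) (\<lambda>\<omega>. \<lambda>k\<in>{i}. X k \<omega>)
        (PiM {j} (\<lambda>_. borel)) (\<lambda>\<omega>. \<lambda>k\<in>{j}. X k \<omega>)"
      using that by (intro indep_var_restrict[OF indep_X]) auto
    from indep_var_compose[OF this, of "\<lambda>f. f i" borel "\<lambda>f. f j" borel]
    show "indep_var borel (X i) borel (X j)"
      by (simp add: comp_def)
  qed (use that AE_X_neq in auto)
  then have "AE \<omega> in M. \<forall>i\<in>{1..n}. \<forall>j\<in>{1..n} - {i}. X i \<omega> \<noteq> X j \<omega>"
    by (intro AE_finite_allI) auto
  then show ?thesis
    by eventually_elim (auto simp: inj_on_def)
qed

text \<open>This turns the hypothesis on the ranks of \<open>Y\<close> into one on the random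
  permutation.\<close>

lemma AE_initial_rank: "AE \<omega> in M. \<forall>k\<in>{1..n}. initial_rank Y k \<omega> = perm_rank (\<mu> \<omega>) k"
  using AE_inj_on_X AE_space
  by eventually_elim (auto intro!: initial_rank_rearrangement permutes_\<mu>)

lemma indep_rv_desc_stat:
  assumes "j \<in> {1..n}"
  shows "indep_rv borel (desc_stat n X j) (permutation_space n) \<mu>"
  using indep_rv_compose[OF indep_\<mu> _ measurable_ident, of "\<lambda>f. f j" borel] assms
  by simp

lemma measurable_desc_stat: "j \<in> {1..n} \<Longrightarrow> desc_stat n X j \<in> borel_measurable M"
  using indep_rv_desc_stat by (simp add: indep_rv_def)

lemma AE_desc_stat_bounds: "AE \<omega> in M. \<forall>j\<in>{1..n}. desc_stat n X j \<omega> \<in> {0..1}"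
proof -
  have "AE \<omega> in M. \<forall>i\<in>{1..n}. X i \<omega> \<in> {0..1}"
    using AE_X_bounds by (intro AE_finite_allI) auto
  then show ?thesis
    by eventually_elim (metis desc_stat_mem)
qed

lemma integrable_desc_stat: "j \<in> {1..n} \<Longrightarrow> integrable M (desc_stat n X j)"
  using AE_desc_stat_bounds measurable_desc_stat
  by (intro integrable_const_bound[where B = 1]) auto

text \<open>Almost surely there are no ties, so the order statistics are strictly ordered there, and
  integration over a space of positive measure keeps the inequality strict.\<close>

lemma expectation_desc_stat_less:
  assumes "j \<in> {1..n}" "k \<in> {1..n}" "j < k"
  shows "expectation (desc_stat n X k) < expectation (desc_stat n X j)"
proof (rule integral_less_AE_space)
  show "AE \<omega> in M. desc_stat n X k \<omega> < desc_stat n X j \<omega>"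
    using AE_inj_on_X by eventually_elim (rule desc_stat_strict_decreasing[OF _ assms])
qed (use assms integrable_desc_stat in \<open>auto simp: emeasure_space_1\<close>)

lemma expectation_desc_stat_inj:
  assumes "j \<in> {1..n}" "k \<in> {1..n}" "expectation (desc_stat n X j) = expectation (desc_stat n X k)"
  shows "j = k"
  using assms expectation_desc_stat_less[of j k] expectation_desc_stat_less[of k j]
  by (cases j k rule: linorder_cases) auto

section \<open>Rank independence and the induction along the indices\<close>

lemma indep_rv_rank_tail:
  assumes "k \<in> {1..<n}"
  shows "indep_rv (\<Pi>\<^sub>M j\<in>{k+1..n}. count_space UNIV) (\<lambda>\<omega>. \<lambda>j\<in>{k+1..n}. initial_rank Y j \<omega>)
    borel (Y k)"
proof -
  have "indep_rv (\<Pi>\<^sub>M j\<in>{k+1..n}. count_space UNIV) (\<lambda>\<omega>. \<lambda>j\<in>{k+1..n}. initial_rank Y j \<omega>)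
      (\<Pi>\<^sub>M i\<in>{1..k}. borel) (\<lambda>\<omega>. \<lambda>i\<in>{1..k}. Y i \<omega>)"
    using rank_indep assms
    by (simp add: strong_rank_independence_def)
  from indep_rv_compose[OF this measurable_ident, of "\<lambda>f. f k" borel]
  show ?thesis
    using assms by simp
qed

lemma integrable_Y:
  assumes "k \<in> {1..<n}"
  shows "integrable M (Y k)"
proof (rule integrable_const_bound[where B = 1])
  show "AE \<omega> in M. norm (Y k \<omega>) \<le> 1"
    using AE_desc_stat_bounds AE_space
  proof eventually_elim
    case (elim \<omega>)
    then have "\<mu> \<omega> k \<in> {1..n}"
      using permutes_in_image[OF permutes_\<mu>] assms by auto
    then show ?case
      using elim by (simp add: rearrangement_def)
  qed
  \<comment> \<open>Measurability is contained in \<open>indep_rv\<close>, which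
    \<open>strong_rank_independence\<close> supplies for \<open>k < n\<close>.\<close>
  show "Y k \<in> borel_measurable M"
    using indep_rv_rank_tail[OF assms] by (simp add: indep_rv_def)
qed

text \<open>With \<open>\<mu>\<close> fixed below \<open>k\<close>, the ranks above \<open>k\<close>
  leave a single possible value for \<open>\<mu> \<omega> k\<close>. Thus the event that this value
  is \<open>j\<close> can be read off both from those ranks and from \<open>\<mu>\<close>, as
  \<open>expectation_eq_of_indep_event\<close> requires.\<close>

lemma expectation_Y_eq:
  assumes k: "k \<in> {1..<n}" and s: "AE \<omega> in M. \<forall>i\<in>{1..<k}. \<mu> \<omega> i = s i"
    and j: "j \<in> {1..n}" and nonnull: "prob {\<omega> \<in> space M. \<mu> \<omega> k = j} \<noteq> 0"
  shows "expectation (Y k) = expectation (desc_stat n X j)"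
proof -
  let ?N = "\<Pi>\<^sub>M j\<in>{k+1..n}. (count_space UNIV :: nat measure)"
  \<comment> \<open>\<open>P\<close> holds the permutations that extend \<open>s\<close> and send
    \<open>k\<close> to \<open>j\<close>, and \<open>S\<close> their rank tails. \<open>S\<close>
    and \<open>T\<close> describe the same event up to a null set, in terms of the ranks and of
    \<open>\<mu>\<close>.\<close>
  define P where "P = {p. p permutes {1..n} \<and> (\<forall>i\<in>{1..<k}. p i = s i) \<and> p k = j}"
  define S where "S = (\<lambda>p. \<lambda>i\<in>{k+1..n}. perm_rank p i) ` P"
  define T where "T = {p. p permutes {1..n} \<and> p k = j}"
  have "finite P"
    by (rule finite_subset[OF _ finite_permutations[of "{1..n}"]]) (auto simp: P_def)
  have "{restrict (perm_rank p) {k+1..n}} \<in> sets ?N" for p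
  proof -
    \<comment> \<open>A single rank vector is a box with one-point sides; \<open>S\<close> is then a
      finite union of such boxes.\<close>
    have "PiE {k+1..n} (\<lambda>i. {restrict (perm_rank p) {k+1..n} i}) \<in> sets ?N"
      by (intro sets_PiM_I_finite) auto
    then show ?thesis
      by (simp only: PiE_singleton[OF restrict_extensional])
  qed
  then have S: "S \<in> sets ?N"
    unfolding S_def using \<open>finite P\<close> by (subst UNION_singleton_eq_range[symmetric]) auto
  have T: "T \<in> sets (permutation_space n)"
    by (auto simp: permutation_space_def T_def)
  have event: "\<mu> \<omega> \<in> T \<longleftrightarrow> \<mu> \<omega> k = j" if "\<omega> \<in> space M" for \<omega>
    using permutes_\<mu>[OF that] by (simp add: T_def)
  show ?thesis
  proof (rule expectation_eq_of_indep_event[OF indep_rv_rank_tail[OF k] integrable_Y[OF k] S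
        indep_rv_desc_stat[OF j] integrable_desc_stat[OF j] T])
    have "{\<omega> \<in> space M. \<mu> \<omega> \<in> T} = {\<omega> \<in> space M. \<mu> \<omega> k = j}"
      using event by blast
    then show "prob {\<omega> \<in> space M. \<mu> \<omega> \<in> T} \<noteq> 0"
      using nonnull by simp
    show "AE \<omega> in M. \<mu> \<omega> \<in> T \<longrightarrow> Y k \<omega> = desc_stat n X j \<omega>"
      by (auto simp: T_def rearrangement_def)
    show "AE \<omega> in M. (\<lambda>j\<in>{k+1..n}. initial_rank Y j \<omega>) \<in> S \<longleftrightarrow> \<mu> \<omega> \<in> T"
      using s AE_initial_rank AE_space
    proof eventually_elim
      case (elim \<omega>)
      note \<mu> = permutes_\<mu>[OF elim(3)]
      have rank: "(\<lambda>j\<in>{k+1..n}. initial_rank Y j \<omega>) = (\<lambda>i\<in>{k+1..n}. perm_rank (\<mu> \<omega>) i)"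
        using elim(2) k by (auto simp: restrict_def)
      \<comment> \<open>A permutation in \<open>P\<close> with the same rank tail agrees with
        \<open>\<mu> \<omega>\<close> above \<open>k\<close> by the ranks and below \<open>k\<close>
        through \<open>s\<close>, hence at \<open>k\<close> too. For the converse,
        \<open>\<mu> \<omega>\<close> itself lies in \<open>P\<close>.\<close>
      have "\<mu> \<omega> k = j" if "p \<in> P"
        and eq: "(\<lambda>i\<in>{k+1..n}. perm_rank (\<mu> \<omega>) i) = (\<lambda>i\<in>{k+1..n}. perm_rank p i)" for p
      proof -
        have p: "p permutes {1..n}" "\<forall>i\<in>{1..<k}. p i = s i" "p k = j"
          using that by (auto simp: P_def)
        have "perm_rank (\<mu> \<omega>) i = perm_rank p i" if "i \<in> {k+1..n}" for i
          using fun_cong[OF eq, of i] that by simp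
        then have "\<mu> \<omega> i = p i" if "i \<in> {k+1..n}" for i
          using that by (rule perm_rank_tail_determines[OF \<mu> p(1)])
        moreover have "\<mu> \<omega> i = p i" if "i \<in> {1..<k}" for i
          using that elim(1) p(2) by simp
        ultimately have "\<mu> \<omega> i = p i" if "i \<in> {1..n}" "i \<noteq> k" for i
          using that by (cases "i < k") auto
        then have "\<mu> \<omega> k = p k"
          by (rule permutes_eq_at_remaining[OF \<mu> p(1), rotated]) (use k in auto)
        then show ?thesis
          by (simp add: p)
      qed
      moreover have "\<mu> \<omega> \<in> P" if "\<mu> \<omega> k = j"
        using that elim(1) \<mu> by (simp add: P_def)
      ultimately show ?case
        unfolding event[OF elim(3)] rank by (auto simp: S_def)
    qed
  qed
qed

lemma AE_\<mu>_initial_const: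
  assumes "k < n"
  shows "\<exists>s. AE \<omega> in M. \<forall>i\<in>{1..<Suc k}. \<mu> \<omega> i = s i"
  using assms
proof (induction k)
  case 0
  then show ?case by simp
next
  case (Suc k)
  then obtain s where s: "AE \<omega> in M. \<forall>i\<in>{1..<Suc k}. \<mu> \<omega> i = s i"
    by auto
  have k: "Suc k \<in> {1..<n}"
    using Suc.prems by simp
  have "\<exists>a. AE \<omega> in M. \<mu> \<omega> (Suc k) = a"
  proof (rule AE_const_if_unique_atom[of "{1..n}"])
    show "(\<lambda>\<omega>. \<mu> \<omega> (Suc k)) \<in> measurable M (count_space UNIV)"
      by (rule measurable_compose[OF measurable_\<mu>]) (simp add: permutation_space_def)
    show "AE \<omega> in M. \<mu> \<omega> (Suc k) \<in> {1..n}"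
      using AE_space
    proof eventually_elim
      case (elim \<omega>)
      then show ?case
        using permutes_in_image[OF permutes_\<mu>[OF elim], of "Suc k"] k by simp
    qed
    \<comment> \<open>Two atoms would give order statistics whose expectations both equal that of
      \<open>Y (Suc k)\<close>.\<close>
    show "a = b" if "a \<in> {1..n}" "b \<in> {1..n}" "prob {\<omega> \<in> space M. \<mu> \<omega> (Suc k) = a} \<noteq> 0"
      "prob {\<omega> \<in> space M. \<mu> \<omega> (Suc k) = b} \<noteq> 0" for a b
      using expectation_Y_eq[OF k s that(1,3)] expectation_Y_eq[OF k s that(2,4)] that(1,2)
      by (intro expectation_desc_stat_inj) auto
  qed simp
  then obtain a where "AE \<omega> in M. \<mu> \<omega> (Suc k) = a" ..
  with s have "AE \<omega> in M. \<forall>i\<in>{1..<Suc (Suc k)}. \<mu> \<omega> i = (s(Suc k := a)) i"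
    by eventually_elim (auto simp: less_Suc_eq)
  then show ?case
    by blast
qed

text \<open>The induction fixes \<open>\<mu>\<close> on \<open>{1..<n}\<close>, and bijectivity
  forces the value at \<open>n\<close>.\<close>

lemma AE_\<mu>_const:
  assumes "n \<ge> 1"
  shows "\<exists>s. s permutes {1..n} \<and> (AE \<omega> in M. \<mu> \<omega> = s)"
proof -
  obtain t where t: "AE \<omega> in M. \<forall>i\<in>{1..<n}. \<mu> \<omega> i = t i"
    using AE_\<mu>_initial_const[of "n - 1"] assms by auto
  \<comment> \<open>\<open>t\<close> is controlled only on \<open>{1..<n}\<close> and may fail to be
    a permutation; the value of \<open>\<mu>\<close> at one good sample point
    \<open>\<omega>0\<close> serves as the witness.\<close>
  have "\<exists>\<omega>\<in>space M. \<forall>i\<in>{1..<n}. \<mu> \<omega> i = t i"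
  proof (rule ccontr)
    assume none: "\<not> ?thesis"
    from t AE_space have "AE \<omega> in M. False"
      by eventually_elim (use none in blast)
    then show False
      by simp
  qed
  then obtain \<omega>0 where \<omega>0: "\<omega>0 \<in> space M" "\<forall>i\<in>{1..<n}. \<mu> \<omega>0 i = t i"
    by blast
  note s = permutes_\<mu>[OF \<omega>0(1)]
  have "AE \<omega> in M. \<mu> \<omega> = \<mu> \<omega>0"
    using t AE_space
  proof eventually_elim
    case (elim \<omega>)
    note \<mu> = permutes_\<mu>[OF elim(2)]
    have eq: "\<mu> \<omega> i = \<mu> \<omega>0 i" if "i \<in> {1..n}" "i \<noteq> n" for i
      using that elim(1) \<omega>0(2) by auto
    moreover have "\<mu> \<omega> n = \<mu> \<omega>0 n"
      using eq by (rule permutes_eq_at_remaining[OF \<mu> s, rotated]) (use assms in auto)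
    \<comment> \<open>Outside \<open>{1..n}\<close> both permutations are the identity, so they are
      equal as functions.\<close>
    ultimately have "\<mu> \<omega> i = \<mu> \<omega>0 i" for i
      using permutes_not_in[OF \<mu>, of i] permutes_not_in[OF s, of i] by (cases "i \<in> {1..n}") auto
    then show ?case ..
  qed
  then show ?thesis
    using s by blast
qed

end

theorem theorem2:
  fixes M :: "'a measure"
    and n :: nat
    and X :: "nat \<Rightarrow> 'a \<Rightarrow> real"
    and \<mu> :: "'a \<Rightarrow> nat \<Rightarrow> nat"
  assumes "prob_space M"
    and "n \<ge> 1"
    and "prob_space.indep_vars M (\<lambda>_. borel) X {1..n}"
    and "\<And>i. i \<in> {1..n} \<Longrightarrow> distr M lborel (X i) = uniform_measure lborel {0..1}"
    and "\<mu> \<in> measurable M (permutation_space n)"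
    and "prob_space.strong_rank_independence M n (rearrangement n X \<mu>)"
    and "prob_space.indep_rv M
           (\<Pi>\<^sub>M k\<in>{1..n}. borel) (\<lambda>\<omega>. \<lambda>k\<in>{1..n}. desc_stat n X k \<omega>)
           (permutation_space n) \<mu>"
  shows "\<exists>s. s permutes {1..n} \<and> (AE \<omega> in M. \<mu> \<omega> = s)"
proof -
  interpret prob_space M by fact
  interpret independent_rearrangement M n X \<mu>
    by unfold_locales (use assms in auto)
  show ?thesis
    using \<open>n \<ge> 1\<close> by (rule AE_\<mu>_const)
qed

end
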